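(* Let $X$ and $Y$ be random elements taking values in measurable spaces $\Omega_X$ and $\Omega_Y$. Suppose that $\{P_{X|Y}(\cdot\,|\,y): y\in\Omega_Y\}$ is dominated by a $\sigma$-finite measure and that $\mathcal G$ is a sub $\sigma$-field of $\sigma(X)$. If $\mathfrak M_{\mathcal G}$ is a complete and sufficient dimension reduction class for $Y$ versus $X$, then $$\mathfrak M_{\mathcal G}=\mathfrak C_{Y|X}=\mathfrak S_{Y|X},$$ where $\mathfrak C_{Y|X}=L_2(P_X)\ominus[L_2(P_X)\ominus L_2(P_Y)]$ is the regression class and $\mathfrak S_{Y|X}$ is the central class.
   Context: $X,Y$ are defined on a probability space $(\Omega,\mathcal F,P)$ and take values in measurable spaces $(\Omega_X,\mathcal F_X)$, $(\Omega_Y,\mathcal F_Y)$; $(X,Y)$ takes values in the product space. $P_X,P_Y,P_{XY}$ are their distributions, dominated by $\sigma$-finite measures, and $P_{X|Y}(\cdot|y)$ is the (regular) conditional distribution of $X$ given $Y=y$. $\sigma(X)=X^{-1}(\mathcal F_X)$. $L_2(P_X)$, $L_2(P_Y)$, $L_2(P_{XY})$ denote the spaces of square-integrable real functions with mean zero (all functions are centered); $L_2(P_X)$ and $L_2(P_Y)$ are viewed as closed subspaces of $L_2(P_{XY})$. For subspaces $\mathcal S_1,\mathcal S_2$ of a Hilbert space, $\mathcal S_1\ominus\mathcal S_2=\mathcal S_1\cap\mathcal S_2^\perp$. For a sub $\sigma$-field $\mathcal G$ of $\sigma(X)$, $\mathfrak M_{\mathcal G}$ is the set of $f\in L_2(P_X)$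 such that $f(X)$ is $\mathcal G$-measurable (up to a.s. equality). $\mathfrak M_{\mathcal G}$ is a sufficient dimension reduction (SDR) class if $Y$ and $X$ are conditionally independent given $\mathcal G$. $\mathfrak M_{\mathcal G}$ is complete if for every $g\in\mathfrak M_{\mathcal G}$, $E[g(X)|Y]=0$ a.s. $P$ implies $g(X)=0$ a.s. $P$. The central $\sigma$-field $\mathcal G_{Y|X}$ is the smallest (modulo $P$-null sets) sub $\sigma$-field $\mathcal G$ of $\sigma(X)$ such that $Y$ and $X$ are conditionally independent given $\mathcal G$; it exists and is unique modulo null sets when $\{P_{X|Y}(\cdot|y):y\in\Omega_Y\}$ is dominated by a $\sigma$-finite measure. The central class is $\mathfrak S_{Y|X}=\mathfrak M_{\mathcal G_{Y|X}}$. *)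

theory Defs
  imports "HOL-Probability.Probability"
begin

text \<open>
  Sub-\<open>\<sigma>\<close>-fields are represented as in \<^theory>\<open>HOL-Probability.Conditional_Expectation\<close>: by a
  measure whose space and sets satisfy \<^const>\<open>subalgebra\<close>; its measure values are irrelevant.
  Elements of \<open>L\<^sub>2\<close> are represented by functions rather than by classes modulo almost sure
  equality.  The sets of functions introduced below that are compared with each other are closed
  under almost sure equality of measurable functions, so that equality of such sets is equality of
  the corresponding sets of classes.
\<close>

definition L2_centered :: "'a measure \<Rightarrow> ('a \<Rightarrow> real) set" where
  "L2_centered N =
    {f \<in> borel_measurable N. integrable N (\<lambda>x. (f x)\<^sup>2) \<and> integral\<^sup>L N f = 0}"

definition ominus ::
  "'a measure \<Rightarrow> ('a \<Rightarrow> real) set \<Rightarrow> ('a \<Rightarrow> real) set \<Rightarrow> ('a \<Rightarrow> real) set" where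
  "ominus N S T = {f \<in> S. \<forall>g\<in>T. (\<integral>x. f x * g x \<partial>N) = 0}"

text \<open>
  The image of a set \<open>S\<close> of functions on a factor space in \<open>L\<^sub>2(N)\<close>, where \<open>\<pi>\<close> is the projection
  to that factor.
\<close>

definition embed_L2 ::
  "'z measure \<Rightarrow> ('z \<Rightarrow> 'a) \<Rightarrow> ('a \<Rightarrow> real) set \<Rightarrow> ('z \<Rightarrow> real) set" where
  "embed_L2 N \<pi> S = {h \<in> L2_centered N. \<exists>f\<in>S. AE z in N. h z = f (\<pi> z)}"

definition joint_law ::
  "'w measure \<Rightarrow> 'x measure \<Rightarrow> 'y measure \<Rightarrow> ('w \<Rightarrow> 'x) \<Rightarrow> ('w \<Rightarrow> 'y) \<Rightarrow> ('x \<times> 'y) measure" where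
  "joint_law M MX MY X Y = distr M (MX \<Otimes>\<^sub>M MY) (\<lambda>\<omega>. (X \<omega>, Y \<omega>))"

definition sigma_field_of :: "'w measure \<Rightarrow> 'x measure \<Rightarrow> ('w \<Rightarrow> 'x) \<Rightarrow> 'w measure" where
  "sigma_field_of M MX X = vimage_algebra (space M) X MX"

definition cond_indep_given :: "'w measure \<Rightarrow> 'w measure \<Rightarrow> 'w measure \<Rightarrow> 'w measure \<Rightarrow> bool" where
  "cond_indep_given M F1 F2 G \<longleftrightarrow>
    (\<forall>A\<in>sets F1. \<forall>B\<in>sets F2. AE \<omega> in M.
      real_cond_exp M G (indicator (A \<inter> B)) \<omega> =
      real_cond_exp M G (indicator A) \<omega> * real_cond_exp M G (indicator B) \<omega>)"

definition regular_cond_distr ::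
  "'w measure \<Rightarrow> 'x measure \<Rightarrow> 'y measure \<Rightarrow> ('w \<Rightarrow> 'x) \<Rightarrow> ('w \<Rightarrow> 'y) \<Rightarrow> ('y \<Rightarrow> 'x measure) \<Rightarrow> bool"
  where
  "regular_cond_distr M MX MY X Y \<kappa> \<longleftrightarrow>
    \<kappa> \<in> MY \<rightarrow>\<^sub>M prob_algebra MX \<and>
    (\<forall>A\<in>sets MX. AE \<omega> in M.
      real_cond_exp M (sigma_field_of M MY Y) (indicator (X -` A \<inter> space M)) \<omega> =
      measure (\<kappa> (Y \<omega>)) A)"

definition dominated_kernel ::
  "'x measure \<Rightarrow> 'y measure \<Rightarrow> ('y \<Rightarrow> 'x measure) \<Rightarrow> bool" where
  "dominated_kernel MX MY \<kappa> \<longleftrightarrow>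
    (\<exists>\<nu>. sets \<nu> = sets MX \<and> sigma_finite_measure \<nu> \<and>
      (\<forall>y\<in>space MY. absolutely_continuous \<nu> (\<kappa> y)))"

definition M_class ::
  "'w measure \<Rightarrow> 'x measure \<Rightarrow> ('w \<Rightarrow> 'x) \<Rightarrow> 'w measure \<Rightarrow> ('x \<Rightarrow> real) set" where
  "M_class M MX X G =
    {f \<in> L2_centered (distr M MX X). \<exists>h\<in>borel_measurable G. AE \<omega> in M. f (X \<omega>) = h \<omega>}"

definition is_sdr ::
  "'w measure \<Rightarrow> 'x measure \<Rightarrow> 'y measure \<Rightarrow> ('w \<Rightarrow> 'x) \<Rightarrow> ('w \<Rightarrow> 'y) \<Rightarrow> 'w measure \<Rightarrow> bool" where
  "is_sdr M MX MY X Y G \<longleftrightarrow>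
    cond_indep_given M (sigma_field_of M MY Y) (sigma_field_of M MX X) G"

definition complete_class ::
  "'w measure \<Rightarrow> 'y measure \<Rightarrow> ('w \<Rightarrow> 'x) \<Rightarrow> ('w \<Rightarrow> 'y) \<Rightarrow> ('x \<Rightarrow> real) set \<Rightarrow> bool" where
  "complete_class M MY X Y S \<longleftrightarrow>
    (\<forall>g\<in>S. (AE \<omega> in M. real_cond_exp M (sigma_field_of M MY Y) (\<lambda>\<omega>. g (X \<omega>)) \<omega> = 0) \<longrightarrow>
      (AE \<omega> in M. g (X \<omega>) = 0))"

definition sets_le_mod_null :: "'w measure \<Rightarrow> 'w measure \<Rightarrow> 'w measure \<Rightarrow> bool" where
  "sets_le_mod_null M F G \<longleftrightarrow>
    (\<forall>A\<in>sets F. \<exists>B\<in>sets G. (A - B) \<union> (B - A) \<in> null_sets M)"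

definition is_central_sigma_field ::
  "'w measure \<Rightarrow> 'x measure \<Rightarrow> 'y measure \<Rightarrow> ('w \<Rightarrow> 'x) \<Rightarrow> ('w \<Rightarrow> 'y) \<Rightarrow> 'w measure \<Rightarrow> bool" where
  "is_central_sigma_field M MX MY X Y C \<longleftrightarrow>
    subalgebra (sigma_field_of M MX X) C \<and> is_sdr M MX MY X Y C \<and>
    (\<forall>G. subalgebra (sigma_field_of M MX X) G \<and> is_sdr M MX MY X Y G \<longrightarrow>
      sets_le_mod_null M C G)"

text \<open>
  The smallest \<open>\<sigma>\<close>-field is unique only modulo null sets; the choice does not affect
  the class of functions measurable with respect to it up to almost sure equality.
\<close>

definition central_sigma_field ::
  "'w measure \<Rightarrow> 'x measure \<Rightarrow> 'y measure \<Rightarrow> ('w \<Rightarrow> 'x) \<Rightarrow> ('w \<Rightarrow> 'y) \<Rightarrow> 'w measure" where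
  "central_sigma_field M MX MY X Y = (SOME C. is_central_sigma_field M MX MY X Y C)"

definition central_class ::
  "'w measure \<Rightarrow> 'x measure \<Rightarrow> 'y measure \<Rightarrow> ('w \<Rightarrow> 'x) \<Rightarrow> ('w \<Rightarrow> 'y) \<Rightarrow> ('x \<Rightarrow> real) set" where
  "central_class M MX MY X Y = M_class M MX X (central_sigma_field M MX MY X Y)"

definition L2_X ::
  "'w measure \<Rightarrow> 'x measure \<Rightarrow> 'y measure \<Rightarrow> ('w \<Rightarrow> 'x) \<Rightarrow> ('w \<Rightarrow> 'y) \<Rightarrow> ('x \<times> 'y \<Rightarrow> real) set" where
  "L2_X M MX MY X Y = embed_L2 (joint_law M MX MY X Y) fst (L2_centered (distr M MX X))"

definition L2_Y ::
  "'w measure \<Rightarrow> 'x measure \<Rightarrow> 'y measure \<Rightarrow> ('w \<Rightarrow> 'x) \<Rightarrow> ('w \<Rightarrow> 'y) \<Rightarrow> ('x \<times> 'y \<Rightarrow> real) set" where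
  "L2_Y M MX MY X Y = embed_L2 (joint_law M MX MY X Y) snd (L2_centered (distr M MY Y))"

definition regression_class ::
  "'w measure \<Rightarrow> 'x measure \<Rightarrow> 'y measure \<Rightarrow> ('w \<Rightarrow> 'x) \<Rightarrow> ('w \<Rightarrow> 'y) \<Rightarrow> ('x \<times> 'y \<Rightarrow> real) set" where
  "regression_class M MX MY X Y =
    ominus (joint_law M MX MY X Y) (L2_X M MX MY X Y)
      (ominus (joint_law M MX MY X Y) (L2_X M MX MY X Y) (L2_Y M MX MY X Y))"

end

theory Submission
  imports Defs
begin

text \<open>
  Write \<open>P\<^sub>G\<close>, \<open>P\<^sub>Y\<close>, \<open>P\<^sub>H\<close> for the conditional expectations given \<open>G\<close>, \<open>Y\<close> and another
  \<open>\<sigma>\<close>-field \<open>H\<close>; on square-integrable variables they are orthogonal projections.  Sufficiency of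
  \<open>G\<close> enters only through the tower property \<open>P\<^sub>Y P\<^sub>G u = P\<^sub>Y u\<close> for square-integrable functions
  \<open>u\<close> of \<open>X\<close> (\<open>sufficient_tower\<close>), although \<open>G\<close> is not comparable with the \<open>\<sigma>\<close>-field of \<open>Y\<close>.
  Completeness says that \<open>P\<^sub>Y\<close> is injective on the \<open>G\<close>-measurable variables.

  \<^bold>\<open>Regression class.\<close>  A function \<open>r\<close> of \<open>X\<close> is orthogonal to the functions of \<open>Y\<close> exactly when
  \<open>P\<^sub>Y r = 0\<close> (\<open>X_minus_Y_iff\<close>), so the regression class is the orthogonal complement of the kernel
  of \<open>P\<^sub>Y\<close> among functions of \<open>X\<close>.  If \<open>P\<^sub>Y r = 0\<close>, then \<open>P\<^sub>Y P\<^sub>G r = 0\<close> by the tower property and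
  \<open>P\<^sub>G r = 0\<close> by completeness, hence \<open>r\<close> is orthogonal to every \<open>G\<close>-measurable variable.
  Conversely, let \<open>u\<close> be orthogonal to that kernel.  The tower property puts \<open>u - P\<^sub>G u\<close> in the kernel,
  so \<open>u\<close>, and also \<open>P\<^sub>G u\<close>, is orthogonal to \<open>u - P\<^sub>G u\<close>; therefore \<open>u = P\<^sub>G u\<close>.

  \<^bold>\<open>Central class.\<close>  Let \<open>H\<close> be any sufficient \<open>\<sigma>\<close>-field and \<open>u\<close> a \<open>G\<close>-measurable variable.  Two uses
  of the tower property give \<open>P\<^sub>Y P\<^sub>G P\<^sub>H u = P\<^sub>Y P\<^sub>H u = P\<^sub>Y u\<close>, and completeness gives \<open>P\<^sub>G P\<^sub>H u = u\<close>.
  Projections do not increase the norm, and strictly decrease it off their range, so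
  \<open>P\<^sub>H u = u\<close> (\<open>fixed_by_two_projections\<close>).
  Taking indicators for \<open>u\<close>, every set in \<open>G\<close> agrees with one in \<open>H\<close> up to a null set: \<open>G\<close> itself is a
  central \<open>\<sigma>\<close>-field.  Any other one agrees with \<open>G\<close> modulo null sets and thus yields the same class
  of functions (\<open>M_class_mono_mod_null\<close>).
\<close>

section \<open>Square-integrable random variables and conditional expectation\<close>

definition square_integrable :: "'a measure \<Rightarrow> ('a \<Rightarrow> real) \<Rightarrow> bool" where
  "square_integrable M f \<longleftrightarrow> f \<in> borel_measurable M \<and> integrable M (\<lambda>x. (f x)\<^sup>2)"

lemma square_integrable_mult:
  assumes "square_integrable M f" "square_integrable M g"
  shows "integrable M (\<lambda>x. f x * g x)"
proof (rule Bochner_Integration.integrable_bound[where f = "\<lambda>x. (f x)\<^sup>2 + (g x)\<^sup>2"])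
  have "\<bar>a * b\<bar> \<le> a\<^sup>2 + b\<^sup>2" for a b :: real
  proof -
    have "2 * (\<bar>a\<bar> * \<bar>b\<bar>) \<le> a\<^sup>2 + b\<^sup>2"
      using sum_squares_bound[of "\<bar>a\<bar>" "\<bar>b\<bar>"] by simp
    moreover have "0 \<le> \<bar>a\<bar> * \<bar>b\<bar>" by simp
    ultimately show ?thesis unfolding abs_mult by linarith
  qed
  then show "AE x in M. norm (f x * g x) \<le> norm ((f x)\<^sup>2 + (g x)\<^sup>2)"
    by (intro AE_I2) (auto simp: abs_of_nonneg)
qed (use assms in \<open>auto simp: square_integrable_def\<close>)

lemma square_integrable_diff:
  assumes "square_integrable M f" "square_integrable M g"
  shows "square_integrable M (\<lambda>x. f x - g x)"
proof -
  have "integrable M (\<lambda>x. (f x)\<^sup>2 + (g x)\<^sup>2 - 2 * (f x * g x))"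
    using assms square_integrable_mult[OF assms] by (auto simp: square_integrable_def)
  moreover have "(\<lambda>x. (f x)\<^sup>2 + (g x)\<^sup>2 - 2 * (f x * g x)) = (\<lambda>x. (f x - g x)\<^sup>2)"
    by (auto simp: power2_diff)
  ultimately show ?thesis
    using assms by (auto simp: square_integrable_def)
qed

lemma square_integrable_cong_AE:
  assumes "square_integrable M f" "g \<in> borel_measurable M" "AE x in M. g x = f x"
  shows "square_integrable M g"
proof -
  have "integrable M (\<lambda>x. (g x)\<^sup>2)"
    by (rule integrable_cong_AE_imp[where g = "\<lambda>x. (f x)\<^sup>2"])
      (use assms in \<open>auto simp: square_integrable_def\<close>)
  then show ?thesis using assms by (simp add: square_integrable_def)
qed

lemma subalgebra_trans: "subalgebra M F \<Longrightarrow> subalgebra F G \<Longrightarrow> subalgebra M G"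
  by (auto simp: subalgebra_def)

context prob_space
begin

lemma square_integrable_imp_integrable': "square_integrable M f \<Longrightarrow> integrable M f"
  unfolding square_integrable_def by (blast intro: square_integrable_imp_integrable)

lemma square_integrable_indicator:
  assumes [measurable]: "A \<in> sets M"
  shows "square_integrable M (indicator A)"
proof -
  have "(\<lambda>x. (indicator A x :: real)\<^sup>2) = indicator A" by (auto simp: indicator_def)
  then show ?thesis by (simp add: square_integrable_def emeasure_eq_measure)
qed

lemma sigma_finite_subalgebraI: "subalgebra M F \<Longrightarrow> sigma_finite_subalgebra M F"
  by (intro finite_measure_subalgebra_is_sigma_finite finite_measure_subalgebra.intro
      finite_measure_subalgebra_axioms.intro finite_measure_axioms)

lemma square_integrable_cond_exp:
  assumes "subalgebra M F" "square_integrable M f"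
  shows "square_integrable M (real_cond_exp M F f)"
proof -
  interpret F: sigma_finite_subalgebra M F
    using assms(1) by (rule sigma_finite_subalgebraI)
  have "integrable M (\<lambda>x. (real_cond_exp M F f x)\<^sup>2)"
    by (rule F.integrable_convex_cond_exp[where I = UNIV])
      (use assms square_integrable_imp_integrable'[OF assms(2)] convex_power2
        in \<open>auto simp: square_integrable_def\<close>)
  then show ?thesis by (simp add: square_integrable_def)
qed

lemma integral_mult_cond_exp:
  assumes "subalgebra M F" "square_integrable M f" "f \<in> borel_measurable F"
    "square_integrable M g"
  shows "(\<integral>x. f x * real_cond_exp M F g x \<partial>M) = (\<integral>x. f x * g x \<partial>M)"
proof -
  interpret F: sigma_finite_subalgebra M F
    using assms(1) by (rule sigma_finite_subalgebraI)
  show ?thesis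
    using F.real_cond_exp_intg(2)[OF square_integrable_mult[OF assms(2,4)] assms(3)] assms(4)
    by (simp add: square_integrable_def)
qed

text \<open>
  The expression in the hypothesis is the squared distance \<open>\<parallel>f - g\<parallel>\<^sup>2\<close> expanded by bilinearity, the
  form in which the orthogonality relations of projections apply.
\<close>

lemma AE_eq_if_square_dist_nonpos:
  assumes "square_integrable M f" "square_integrable M g"
    and "(\<integral>x. f x * f x \<partial>M) - 2 * (\<integral>x. f x * g x \<partial>M) + (\<integral>x. g x * g x \<partial>M) \<le> 0"
  shows "AE x in M. f x = g x"
proof -
  note [simp] = square_integrable_mult[OF assms(1) assms(1)] square_integrable_mult[OF assms(1) assms(2)]
    square_integrable_mult[OF assms(2) assms(2)]
  have i: "integrable M (\<lambda>x. (f x - g x)\<^sup>2)"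
    using square_integrable_diff[OF assms(1,2)] by (simp add: square_integrable_def)
  have "(\<integral>x. (f x - g x)\<^sup>2 \<partial>M) = (\<integral>x. (f x * f x - 2 * (f x * g x)) + g x * g x \<partial>M)"
    by (simp add: power2_eq_square algebra_simps)
  also have "\<dots> \<le> 0"
    using assms(3) by simp
  finally have "(\<integral>x. (f x - g x)\<^sup>2 \<partial>M) \<le> 0" .
  moreover have "0 \<le> (\<integral>x. (f x - g x)\<^sup>2 \<partial>M)" by simp
  ultimately have "(\<integral>x. (f x - g x)\<^sup>2 \<partial>M) = 0" by linarith
  then have "AE x in M. (f x - g x)\<^sup>2 = 0"
    using integral_nonneg_eq_0_iff_AE[OF i] by auto
  then show ?thesis by auto
qed

text \<open>
  With \<open>v = P\<^sub>H u\<close> and \<open>u = P\<^sub>F v\<close>, self-adjointness of the two projections gives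
  \<open>\<parallel>u\<parallel>\<^sup>2 = \<langle>u, v\<rangle> = \<parallel>v\<parallel>\<^sup>2\<close>, so the distance of \<open>u\<close> and \<open>v\<close> is zero.
\<close>

lemma fixed_by_two_projections:
  assumes F: "subalgebra M F" and H: "subalgebra M H" and u: "square_integrable M u"
    and eq: "AE x in M. real_cond_exp M F (real_cond_exp M H u) x = u x"
  shows "AE x in M. u x = real_cond_exp M H u x"
proof (rule AE_eq_if_square_dist_nonpos[OF u])
  define v where "v = real_cond_exp M H u"
  define w where "w = real_cond_exp M F v"
  have v: "square_integrable M v" "v \<in> borel_measurable H"
    using square_integrable_cond_exp[OF H u] by (auto simp: v_def)
  have w: "square_integrable M w" "w \<in> borel_measurable F"
    using square_integrable_cond_exp[OF F v(1)] by (auto simp: w_def)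
  note [measurable] = v(1)[unfolded square_integrable_def, THEN conjunct1]
    w(1)[unfolded square_integrable_def, THEN conjunct1]
    u[unfolded square_integrable_def, THEN conjunct1]
  have wu: "AE x in M. w x = u x"
    using eq by (simp add: w_def v_def)
  have "(\<integral>x. u x * u x \<partial>M) = (\<integral>x. w x * w x \<partial>M)"
    by (rule integral_cong_AE) (use wu in auto)
  also have "\<dots> = (\<integral>x. w x * v x \<partial>M)"
    using integral_mult_cond_exp[OF F w v(1)] by (simp add: w_def)
  also have "\<dots> = (\<integral>x. u x * v x \<partial>M)"
    by (rule integral_cong_AE) (use wu in auto)
  finally have 1: "(\<integral>x. u x * u x \<partial>M) = (\<integral>x. u x * v x \<partial>M)" .
  have 2: "(\<integral>x. v x * v x \<partial>M) = (\<integral>x. u x * v x \<partial>M)"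
    using integral_mult_cond_exp[OF H v u] by (simp add: v_def mult.commute)
  show "square_integrable M (real_cond_exp M H u)"
    using v by (simp add: v_def)
  show "(\<integral>x. u x * u x \<partial>M) - 2 * (\<integral>x. u x * real_cond_exp M H u x \<partial>M) +
      (\<integral>x. real_cond_exp M H u x * real_cond_exp M H u x \<partial>M) \<le> 0"
    using 1 2 by (simp add: v_def)
qed

section \<open>Sufficiency as a tower property\<close>

text \<open>
  Conditional independence in its one-sided form: once \<open>G\<close> is known, the rest of \<open>X\<close> does not change
  the conditional probability of an event \<open>B\<close> about \<open>Y\<close>.  Integrating
  \<open>P\<^sub>G(1\<^sub>A 1\<^sub>B) = P\<^sub>G 1\<^sub>A \<cdot> P\<^sub>G 1\<^sub>B\<close> shows that \<open>P\<^sub>G 1\<^sub>B\<close> has the same integral as \<open>1\<^sub>B\<close> over each event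
  \<open>A\<close> about \<open>X\<close>, which characterizes the conditional probability of \<open>B\<close> given \<open>X\<close>.
\<close>

lemma cond_exp_indicator_of_sufficient:
  assumes FX: "subalgebra M FX" and FY: "subalgebra M FY" and G: "subalgebra FX G"
    and ci: "cond_indep_given M FY FX G" and B: "B \<in> sets FY"
  shows "AE x in M. real_cond_exp M FX (indicator B) x = real_cond_exp M G (indicator B) x"
proof -
  have GM: "subalgebra M G" using FX G by (rule subalgebra_trans)
  interpret X: sigma_finite_subalgebra M FX using FX by (rule sigma_finite_subalgebraI)
  interpret G: sigma_finite_subalgebra M G using GM by (rule sigma_finite_subalgebraI)
  have [measurable]: "B \<in> sets M" using B FY by (auto simp: subalgebra_def)
  show ?thesis
  proof (rule X.real_cond_exp_charact)
    fix A assume A: "A \<in> sets FX"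
    then have [measurable]: "A \<in> sets M" using FX by (auto simp: subalgebra_def)
    have iAB: "integrable M (indicator (B \<inter> A) :: _ \<Rightarrow> real)"
      by (simp add: emeasure_eq_measure)
    have sq: "square_integrable M (indicator A :: _ \<Rightarrow> real)"
      "square_integrable M (indicator B :: _ \<Rightarrow> real)"
      by (auto intro: square_integrable_indicator)
    have sB: "square_integrable M (real_cond_exp M G (indicator B))"
      by (rule square_integrable_cond_exp[OF GM sq(2)])
    have "(\<integral>x\<in>A. indicator B x \<partial>M) = (\<integral>x. indicator (B \<inter> A) x \<partial>M)"
      unfolding set_lebesgue_integral_def
      by (intro Bochner_Integration.integral_cong) (auto simp: indicator_def)
    also have "\<dots> = (\<integral>x. real_cond_exp M G (indicator (B \<inter> A)) x \<partial>M)"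
      using G.real_cond_exp_int(2)[OF iAB] by simp
    also have "\<dots> = (\<integral>x. real_cond_exp M G (indicator B) x * real_cond_exp M G (indicator A) x \<partial>M)"
      by (rule integral_cong_AE) (use ci A B in \<open>auto simp: cond_indep_given_def\<close>)
    also have "\<dots> = (\<integral>x. real_cond_exp M G (indicator B) x * indicator A x \<partial>M)"
      by (rule integral_mult_cond_exp[OF GM sB _ sq(1)]) simp
    finally show "(\<integral>x\<in>A. indicator B x \<partial>M) = (\<integral>x\<in>A. real_cond_exp M G (indicator B) x \<partial>M)"
      by (simp add: set_lebesgue_integral_def mult.commute)
  next
    show "integrable M (indicator B :: _ \<Rightarrow> real)"
      by (simp add: emeasure_eq_measure)
    then show "integrable M (real_cond_exp M G (indicator B))" by (rule G.real_cond_exp_int)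
    show "real_cond_exp M G (indicator B) \<in> borel_measurable FX"
      by (rule measurable_from_subalg[OF G]) simp
  qed
qed

text \<open>
  For an event \<open>B\<close> about \<open>Y\<close>, moving projections across the inner product gives
  \<open>\<langle>P\<^sub>G u, 1\<^sub>B\<rangle> = \<langle>u, P\<^sub>G 1\<^sub>B\<rangle>\<close>.  Here \<open>P\<^sub>G 1\<^sub>B\<close> may be replaced by the conditional probability of \<open>B\<close> given
  \<open>X\<close>, and since \<open>u\<close> is a function of \<open>X\<close> the result is \<open>\<langle>u, 1\<^sub>B\<rangle>\<close>.
\<close>

lemma sufficient_tower:
  assumes FX: "subalgebra M FX" and FY: "subalgebra M FY" and G: "subalgebra FX G"
    and ci: "cond_indep_given M FY FX G"
    and u: "square_integrable M u" "u \<in> borel_measurable FX"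
  shows "AE x in M. real_cond_exp M FY (real_cond_exp M G u) x = real_cond_exp M FY u x"
proof -
  have GM: "subalgebra M G" using FX G by (rule subalgebra_trans)
  interpret Y: sigma_finite_subalgebra M FY using FY by (rule sigma_finite_subalgebraI)
  define v where "v = real_cond_exp M G u"
  have v: "square_integrable M v" "v \<in> borel_measurable G"
    using square_integrable_cond_exp[OF GM u(1)] by (auto simp: v_def)
  note [measurable] = v(1)[unfolded square_integrable_def, THEN conjunct1]
    u(1)[unfolded square_integrable_def, THEN conjunct1]
  have iv: "integrable M v" and iu: "integrable M u"
    using v u by (auto intro: square_integrable_imp_integrable')
  show ?thesis
  proof (rule Y.real_cond_exp_charact, unfold v_def[symmetric])
    fix B assume B: "B \<in> sets FY"
    then have [measurable]: "B \<in> sets M" using FY by (auto simp: subalgebra_def)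
    define b where "b = real_cond_exp M G (indicator B :: _ \<Rightarrow> real)"
    have sq: "square_integrable M (indicator B :: _ \<Rightarrow> real)"
      by (auto intro: square_integrable_indicator)
    have b: "square_integrable M b" "b \<in> borel_measurable G"
      using square_integrable_cond_exp[OF GM sq] by (auto simp: b_def)
    note [measurable] = b(1)[unfolded square_integrable_def, THEN conjunct1]
    have "(\<integral>x\<in>B. v x \<partial>M) = (\<integral>x. v x * indicator B x \<partial>M)"
      by (simp add: set_lebesgue_integral_def mult.commute)
    also have "\<dots> = (\<integral>x. v x * b x \<partial>M)"
      using integral_mult_cond_exp[OF GM v sq] by (simp add: b_def)
    also have "\<dots> = (\<integral>x. b x * u x \<partial>M)"
      using integral_mult_cond_exp[OF GM b u(1)] by (simp add: v_def mult.commute)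
    also have "\<dots> = (\<integral>x. u x * real_cond_exp M FX (indicator B) x \<partial>M)"
      by (rule integral_cong_AE)
        (use cond_exp_indicator_of_sufficient[OF FX FY G ci B] in \<open>auto simp: b_def\<close>)
    also have "\<dots> = (\<integral>x. u x * indicator B x \<partial>M)"
      by (rule integral_mult_cond_exp[OF FX u sq])
    finally show "(\<integral>x\<in>B. v x \<partial>M) = (\<integral>x\<in>B. real_cond_exp M FY u x \<partial>M)"
      using Y.real_cond_exp_intA[OF iu B] by (simp add: set_lebesgue_integral_def mult.commute)
  qed (use iv iu Y.real_cond_exp_int(1) in auto)
qed

end

section \<open>Functions determined by rational sublevel sets\<close>

text \<open>
  A real number \<open>c\<close> is the infimum of the rationals above it, so a function can be rebuilt from the
  sets on which it lies below each rational.  The conclusion concerns only points \<open>x\<close> at which the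
  sets \<open>B q\<close> are the sublevel sets of a number; this lets the lemma produce both an exact
  factorization through a map and a modification on a null set.
\<close>

lemma measurable_from_sublevel_sets:
  fixes B :: "rat \<Rightarrow> 'a set"
  assumes B: "\<And>q. B q \<in> sets N"
  obtains g :: "'a \<Rightarrow> real" where "g \<in> borel_measurable N"
    "\<And>x c. (\<And>q. x \<in> B q \<longleftrightarrow> c < of_rat q) \<Longrightarrow> g x = c"
proof
  define g' :: "'a \<Rightarrow> ereal"
    where "g' x = (INF q. if x \<in> B q then ereal (of_rat q) else \<infinity>)" for x
  show "(\<lambda>x. real_of_ereal (g' x)) \<in> borel_measurable N"
    unfolding g'_def using B by measurable
  fix x and c :: real assume *: "\<And>q. x \<in> B q \<longleftrightarrow> c < of_rat q"
  have "g' x = ereal c"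
  proof (rule antisym)
    show "ereal c \<le> g' x"
      unfolding g'_def using * by (intro INF_greatest) auto
    show "g' x \<le> ereal c"
    proof (rule ereal_le_epsilon2)
      fix e :: real assume "0 < e"
      then obtain q where q: "c < of_rat q" "of_rat q < c + e"
        using of_rat_dense[of c "c + e"] by auto
      have "g' x \<le> (if x \<in> B q then ereal (of_rat q) else \<infinity>)"
        unfolding g'_def by (rule INF_lower) simp
      then show "g' x \<le> ereal c + ereal e"
        using * q by (auto intro: order_trans)
    qed
  qed
  then show "real_of_ereal (g' x) = c" by simp
qed

text \<open>
  The Doob-Dynkin lemma for real functions: each rational sublevel set of \<open>h\<close> is the preimage of a
  measurable set, and these sets determine \<open>g\<close>.
\<close>

lemma vimage_algebra_factorization:
  fixes h :: "'w \<Rightarrow> real"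
  assumes X: "X \<in> \<Omega> \<rightarrow> space MX" and h: "h \<in> borel_measurable (vimage_algebra \<Omega> X MX)"
  obtains g where "g \<in> borel_measurable MX" "\<And>\<omega>. \<omega> \<in> \<Omega> \<Longrightarrow> g (X \<omega>) = h \<omega>"
proof -
  have "\<exists>A\<in>sets MX. {\<omega> \<in> \<Omega>. h \<omega> < of_rat q} = X -` A \<inter> \<Omega>" for q
  proof -
    have "{\<omega> \<in> space (vimage_algebra \<Omega> X MX). h \<omega> < of_rat q} \<in> sets (vimage_algebra \<Omega> X MX)"
      using h by measurable
    then show ?thesis by (auto simp: sets_vimage_algebra2[OF X])
  qed
  then obtain A where A: "\<And>q. A q \<in> sets MX" "\<And>q. {\<omega> \<in> \<Omega>. h \<omega> < of_rat q} = X -` A q \<inter> \<Omega>"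
    by metis
  obtain g :: "_ \<Rightarrow> real" where g: "g \<in> borel_measurable MX"
    "\<And>x c. (\<And>q. x \<in> A q \<longleftrightarrow> c < of_rat q) \<Longrightarrow> g x = c"
    using measurable_from_sublevel_sets[of A MX] A(1) by blast
  show ?thesis
  proof (rule that[OF g(1)])
    fix \<omega> assume "\<omega> \<in> \<Omega>"
    then show "g (X \<omega>) = h \<omega>" using A(2) by (intro g(2)) blast
  qed
qed

text \<open>
  Each rational sublevel set of \<open>h\<close> differs by a null set from a set in \<open>G\<close>.  As there are only
  countably many rationals, outside one null set the substitutes still determine the value of \<open>h\<close>.
\<close>

lemma modification_measurable_mod_null:
  fixes h :: "'w \<Rightarrow> real"
  assumes le: "sets_le_mod_null M F G" and F: "subalgebra M F" and h: "h \<in> borel_measurable F"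
  obtains k where "k \<in> borel_measurable G" "AE \<omega> in M. k \<omega> = h \<omega>"
proof -
  define D where "D q = {\<omega> \<in> space M. h \<omega> < of_rat q}" for q
  have "\<exists>B. B \<in> sets G \<and> (D q - B) \<union> (B - D q) \<in> null_sets M" for q
  proof -
    have "{\<omega> \<in> space F. h \<omega> < of_rat q} \<in> sets F" using h by measurable
    then have "D q \<in> sets F" using F by (simp add: D_def subalgebra_def)
    then show ?thesis using le unfolding sets_le_mod_null_def by blast
  qed
  then have "\<exists>B. \<forall>q. B q \<in> sets G \<and> (D q - B q) \<union> (B q - D q) \<in> null_sets M"
    by (intro choice allI)
  then obtain B where B: "\<And>q. B q \<in> sets G" "\<And>q. (D q - B q) \<union> (B q - D q) \<in> null_sets M"
    by blast
  obtain k :: "_ \<Rightarrow> real" where k: "k \<in> borel_measurable G"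
    "\<And>x c. (\<And>q. x \<in> B q \<longleftrightarrow> c < of_rat q) \<Longrightarrow> k x = c"
    using measurable_from_sublevel_sets[of B G] B(1) by blast
  have "AE \<omega> in M. \<forall>q. \<omega> \<in> B q \<longleftrightarrow> h \<omega> < of_rat q"
    unfolding AE_all_countable
  proof
    fix q show "AE \<omega> in M. \<omega> \<in> B q \<longleftrightarrow> h \<omega> < of_rat q"
      using AE_not_in[OF B(2)[of q]] AE_space by eventually_elim (auto simp: D_def)
  qed
  then have "AE \<omega> in M. k \<omega> = h \<omega>"
    by eventually_elim (auto intro: k(2))
  then show ?thesis using that k(1) by blast
qed

section \<open>Passing between laws and random variables\<close>

lemma L2_centered_distr_iff:
  assumes "X \<in> M \<rightarrow>\<^sub>M MX"
  shows "f \<in> L2_centered (distr M MX X) \<longleftrightarrow> f \<in> borel_measurable MX \<and>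
    square_integrable M (\<lambda>\<omega>. f (X \<omega>)) \<and> (\<integral>\<omega>. f (X \<omega>) \<partial>M) = 0"
  using assms by (auto simp: L2_centered_def square_integrable_def integrable_distr_eq integral_distr)

lemma subalgebra_sigma_field_of: "X \<in> M \<rightarrow>\<^sub>M MX \<Longrightarrow> subalgebra M (sigma_field_of M MX X)"
  by (simp add: subalgebra_def sigma_field_of_def sets_image_in_sets)

lemma measurable_sigma_field_of:
  "X \<in> M \<rightarrow>\<^sub>M MX \<Longrightarrow> f \<in> borel_measurable MX \<Longrightarrow>
    (\<lambda>\<omega>. f (X \<omega>)) \<in> borel_measurable (sigma_field_of M MX X)"
  unfolding sigma_field_of_def
  by (rule measurable_compose[OF measurable_vimage_algebra1]) (auto dest: measurable_space)

lemma sigma_field_of_factorization: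
  fixes h :: "'w \<Rightarrow> real"
  assumes "X \<in> M \<rightarrow>\<^sub>M MX" "h \<in> borel_measurable (sigma_field_of M MX X)"
  obtains g where "g \<in> borel_measurable MX" "\<And>\<omega>. \<omega> \<in> space M \<Longrightarrow> g (X \<omega>) = h \<omega>"
proof -
  have "X \<in> space M \<rightarrow> space MX" using assms(1) by (auto dest: measurable_space)
  then show ?thesis
    by (rule vimage_algebra_factorization[OF _ assms(2)[unfolded sigma_field_of_def]]) (rule that)
qed

text \<open>
  Square-integrability and mean zero of \<open>h\<close> under the joint law are inherited from the function on
  the factor space, so besides the almost sure equality only measurability of \<open>h\<close> remains.
\<close>

lemma embed_L2_joint_law_iff:
  assumes X: "X \<in> M \<rightarrow>\<^sub>M MX" and Y: "Y \<in> M \<rightarrow>\<^sub>M MY" and p: "p \<in> MX \<Otimes>\<^sub>M MY \<rightarrow>\<^sub>M MZ"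
    and S: "S \<subseteq> L2_centered (distr M MZ (\<lambda>\<omega>. p (X \<omega>, Y \<omega>)))"
  shows "h \<in> embed_L2 (joint_law M MX MY X Y) p S \<longleftrightarrow> h \<in> borel_measurable (MX \<Otimes>\<^sub>M MY) \<and>
    (\<exists>f\<in>S. AE \<omega> in M. h (X \<omega>, Y \<omega>) = f (p (X \<omega>, Y \<omega>)))"
proof -
  note [measurable] = X Y p
  have XY [measurable]: "(\<lambda>\<omega>. (X \<omega>, Y \<omega>)) \<in> M \<rightarrow>\<^sub>M MX \<Otimes>\<^sub>M MY" by measurable
  have pXY: "(\<lambda>\<omega>. p (X \<omega>, Y \<omega>)) \<in> M \<rightarrow>\<^sub>M MZ" by measurable
  note S' = S[THEN subsetD, unfolded L2_centered_distr_iff[OF pXY]]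
  show ?thesis
  proof (cases "h \<in> borel_measurable (MX \<Otimes>\<^sub>M MY)")
    case False
    then show ?thesis by (auto simp: embed_L2_def joint_law_def L2_centered_def)
  next
    case True
    note [measurable] = True
    have AE: "(AE z in joint_law M MX MY X Y. h z = f (p z)) \<longleftrightarrow>
        (AE \<omega> in M. h (X \<omega>, Y \<omega>) = f (p (X \<omega>, Y \<omega>)))" if "f \<in> S" for f
    proof -
      have [measurable]: "f \<in> borel_measurable MZ" using S'[OF that] by blast
      show ?thesis unfolding joint_law_def by (subst AE_distr_iff) auto
    qed
    have "h \<in> L2_centered (joint_law M MX MY X Y)"
      if "f \<in> S" and ae: "AE \<omega> in M. h (X \<omega>, Y \<omega>) = f (p (X \<omega>, Y \<omega>))" for f
    proof -
      have [measurable]: "f \<in> borel_measurable MZ" using S'[OF that(1)] by blast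
      have "square_integrable M (\<lambda>\<omega>. h (X \<omega>, Y \<omega>))"
        by (rule square_integrable_cong_AE[OF _ _ ae]) (use S'[OF that(1)] in auto)
      moreover have "(\<integral>\<omega>. h (X \<omega>, Y \<omega>) \<partial>M) = (\<integral>\<omega>. f (p (X \<omega>, Y \<omega>)) \<partial>M)"
        by (rule integral_cong_AE) (use ae in auto)
      ultimately show ?thesis
        unfolding joint_law_def using S'[OF that(1)] True by (simp add: L2_centered_distr_iff[OF XY])
    qed
    then show ?thesis
      unfolding embed_L2_def using True AE by blast
  qed
qed

lemma integral_joint_law_mult:
  fixes h k :: "'x \<times> 'y \<Rightarrow> real"
  assumes "X \<in> M \<rightarrow>\<^sub>M MX" "Y \<in> M \<rightarrow>\<^sub>M MY"
    and "h \<in> borel_measurable (MX \<Otimes>\<^sub>M MY)" "k \<in> borel_measurable (MX \<Otimes>\<^sub>M MY)"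
    and "u \<in> borel_measurable M" "v \<in> borel_measurable M"
    and "AE \<omega> in M. h (X \<omega>, Y \<omega>) = u \<omega>" "AE \<omega> in M. k (X \<omega>, Y \<omega>) = v \<omega>"
  shows "(\<integral>z. h z * k z \<partial>joint_law M MX MY X Y) = (\<integral>\<omega>. u \<omega> * v \<omega> \<partial>M)"
proof -
  note [measurable] = assms(1-6)
  have "(\<integral>z. h z * k z \<partial>joint_law M MX MY X Y) = (\<integral>\<omega>. h (X \<omega>, Y \<omega>) * k (X \<omega>, Y \<omega>) \<partial>M)"
    unfolding joint_law_def by (subst integral_distr) auto
  also have "\<dots> = (\<integral>\<omega>. u \<omega> * v \<omega> \<partial>M)"
    by (rule integral_cong_AE) (use assms(7,8) in auto)
  finally show ?thesis .
qed

lemma L2_X_iff: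
  assumes X: "X \<in> M \<rightarrow>\<^sub>M MX" and Y: "Y \<in> M \<rightarrow>\<^sub>M MY"
  shows "h \<in> L2_X M MX MY X Y \<longleftrightarrow> h \<in> borel_measurable (MX \<Otimes>\<^sub>M MY) \<and>
    (\<exists>f\<in>L2_centered (distr M MX X). AE \<omega> in M. h (X \<omega>, Y \<omega>) = f (X \<omega>))"
  unfolding L2_X_def using embed_L2_joint_law_iff[OF X Y measurable_fst, of "L2_centered (distr M MX X)"]
  by simp

lemma L2_Y_iff:
  assumes X: "X \<in> M \<rightarrow>\<^sub>M MX" and Y: "Y \<in> M \<rightarrow>\<^sub>M MY"
  shows "h \<in> L2_Y M MX MY X Y \<longleftrightarrow> h \<in> borel_measurable (MX \<Otimes>\<^sub>M MY) \<and>
    (\<exists>f\<in>L2_centered (distr M MY Y). AE \<omega> in M. h (X \<omega>, Y \<omega>) = f (Y \<omega>))"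
  unfolding L2_Y_def using embed_L2_joint_law_iff[OF X Y measurable_snd, of "L2_centered (distr M MY Y)"]
  by simp

lemma embed_M_class_iff:
  assumes X: "X \<in> M \<rightarrow>\<^sub>M MX" and Y: "Y \<in> M \<rightarrow>\<^sub>M MY"
  shows "h \<in> embed_L2 (joint_law M MX MY X Y) fst (M_class M MX X G) \<longleftrightarrow>
    h \<in> borel_measurable (MX \<Otimes>\<^sub>M MY) \<and>
    (\<exists>f\<in>M_class M MX X G. AE \<omega> in M. h (X \<omega>, Y \<omega>) = f (X \<omega>))"
  using embed_L2_joint_law_iff[OF X Y measurable_fst, of "M_class M MX X G"]
  by (auto simp: M_class_def)

section \<open>The orthogonal complement of the functions of Y\<close>

context prob_space
begin

text \<open>
  Orthogonality to all functions of \<open>Y\<close> and a vanishing projection onto them are the same thing.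
  Since \<open>L\<^sub>2(P\<^sub>Y)\<close> contains only centered functions, an event about \<open>Y\<close> is tested with its centered
  indicator; the constant subtracted does not matter because \<open>f(X)\<close> has mean zero.
\<close>

lemma X_minus_Y_iff:
  assumes X: "X \<in> M \<rightarrow>\<^sub>M MX" and Y: "Y \<in> M \<rightarrow>\<^sub>M MY"
    and h: "h \<in> borel_measurable (MX \<Otimes>\<^sub>M MY)" and f: "f \<in> L2_centered (distr M MX X)"
    and hf: "AE \<omega> in M. h (X \<omega>, Y \<omega>) = f (X \<omega>)"
  shows "h \<in> ominus (joint_law M MX MY X Y) (L2_X M MX MY X Y) (L2_Y M MX MY X Y) \<longleftrightarrow>
    (AE \<omega> in M. real_cond_exp M (sigma_field_of M MY Y) (\<lambda>\<omega>. f (X \<omega>)) \<omega> = 0)"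
    (is "_ \<longleftrightarrow> (AE \<omega> in M. real_cond_exp M ?FY ?u \<omega> = 0)")
proof -
  note [measurable] = X Y h
  have FY: "subalgebra M ?FY" using Y by (rule subalgebra_sigma_field_of)
  interpret Y: sigma_finite_subalgebra M ?FY using FY by (rule sigma_finite_subalgebraI)
  have [measurable]: "f \<in> borel_measurable MX" and u: "square_integrable M ?u" "(\<integral>\<omega>. ?u \<omega> \<partial>M) = 0"
    using f by (auto simp: L2_centered_distr_iff[OF X])
  have iu: "integrable M ?u" using u(1) by (rule square_integrable_imp_integrable')
  have hX: "h \<in> L2_X M MX MY X Y" using h f hf by (auto simp: L2_X_iff[OF X Y])
  show ?thesis
  proof
    assume "AE \<omega> in M. real_cond_exp M ?FY ?u \<omega> = 0"
    then have z: "AE \<omega> in M. real_cond_exp M ?FY ?u \<omega> = 0" .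
    have "(\<integral>x. h x * k x \<partial>joint_law M MX MY X Y) = 0" if "k \<in> L2_Y M MX MY X Y" for k
    proof -
      obtain g where k: "k \<in> borel_measurable (MX \<Otimes>\<^sub>M MY)" "g \<in> L2_centered (distr M MY Y)"
        "AE \<omega> in M. k (X \<omega>, Y \<omega>) = g (Y \<omega>)"
        using \<open>k \<in> _\<close> unfolding L2_Y_iff[OF X Y] by blast
      have g[measurable]: "g \<in> borel_measurable MY" "square_integrable M (\<lambda>\<omega>. g (Y \<omega>))"
        using k(2) by (auto simp: L2_centered_distr_iff[OF Y])
      have "(\<integral>x. h x * k x \<partial>joint_law M MX MY X Y) = (\<integral>\<omega>. g (Y \<omega>) * ?u \<omega> \<partial>M)"
        using integral_joint_law_mult[OF X Y h k(1) _ _ hf k(3)] by (simp add: mult.commute)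
      also have "\<dots> = (\<integral>\<omega>. g (Y \<omega>) * real_cond_exp M ?FY ?u \<omega> \<partial>M)"
        using integral_mult_cond_exp[OF FY g(2) measurable_sigma_field_of[OF Y g(1)] u(1)] by simp
      also have "\<dots> = (\<integral>\<omega>. 0 \<partial>M)"
        by (rule integral_cong_AE) (use z in auto)
      finally show ?thesis by simp
    qed
    then show "h \<in> ominus (joint_law M MX MY X Y) (L2_X M MX MY X Y) (L2_Y M MX MY X Y)"
      using hX by (auto simp: ominus_def)
  next
    assume "h \<in> ominus (joint_law M MX MY X Y) (L2_X M MX MY X Y) (L2_Y M MX MY X Y)"
    then have orth: "\<And>k. k \<in> L2_Y M MX MY X Y \<Longrightarrow> (\<integral>x. h x * k x \<partial>joint_law M MX MY X Y) = 0"
      by (auto simp: ominus_def)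
    show "AE \<omega> in M. real_cond_exp M ?FY ?u \<omega> = 0"
    proof (rule Y.real_cond_exp_charact)
      fix B assume "B \<in> sets ?FY"
      then obtain B' where B'[measurable]: "B' \<in> sets MY" and B: "B = Y -` B' \<inter> space M"
        using measurable_space[OF Y]
        by (auto simp: sigma_field_of_def sets_vimage_algebra2)
      define c where "c = (\<integral>\<omega>. indicator B' (Y \<omega>) \<partial>M :: real)"
      define g where "g y = indicator B' y - c" for y
      have [measurable]: "g \<in> borel_measurable MY" unfolding g_def by measurable
      have i1: "integrable M (\<lambda>\<omega>. indicator B' (Y \<omega>) :: real)"
        by (rule integrable_const_bound[where B = 1]) auto
      have s1: "square_integrable M (\<lambda>\<omega>. indicator B' (Y \<omega>))"
      proof -
        have "(\<lambda>\<omega>. (indicator B' (Y \<omega>) :: real)\<^sup>2) = (\<lambda>\<omega>. indicator B' (Y \<omega>))"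
          by (auto simp: indicator_def)
        then show ?thesis using i1 by (simp add: square_integrable_def)
      qed
      have "square_integrable M (\<lambda>\<omega>. g (Y \<omega>))"
        unfolding g_def by (rule square_integrable_diff[OF s1]) (auto simp: square_integrable_def)
      moreover have "(\<integral>\<omega>. g (Y \<omega>) \<partial>M) = 0"
        unfolding g_def using i1 by (simp add: c_def prob_space)
      ultimately have "g \<in> L2_centered (distr M MY Y)" by (simp add: L2_centered_distr_iff[OF Y])
      then have "(\<lambda>z. g (snd z)) \<in> L2_Y M MX MY X Y"
        unfolding L2_Y_iff[OF X Y] by (auto intro!: bexI[of _ g])
      then have "0 = (\<integral>\<omega>. ?u \<omega> * g (Y \<omega>) \<partial>M)"
        using orth integral_joint_law_mult[OF X Y h, of "\<lambda>z. g (snd z)" ?u "\<lambda>\<omega>. g (Y \<omega>)"] hf by simp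
      also have "\<dots> = (\<integral>\<omega>. ?u \<omega> * indicator B' (Y \<omega>) - c * ?u \<omega> \<partial>M)"
        by (simp add: g_def algebra_simps)
      also have "\<dots> = (\<integral>\<omega>. ?u \<omega> * indicator B' (Y \<omega>) \<partial>M)"
        using square_integrable_mult[OF u(1) s1] iu u(2) by simp
      also have "\<dots> = (\<integral>\<omega>\<in>B. ?u \<omega> \<partial>M)"
        unfolding set_lebesgue_integral_def B
        by (intro Bochner_Integration.integral_cong) (auto simp: indicator_def)
      finally show "(\<integral>\<omega>\<in>B. ?u \<omega> \<partial>M) = (\<integral>\<omega>\<in>B. 0 \<partial>M)"
        by (simp add: set_lebesgue_integral_def)
    qed (use iu in auto)
  qed
qed

section \<open>Complete sufficient classes\<close>

text \<open>
  Completeness, stated for functions on the space of \<open>X\<close>, carries over to \<open>G\<close>-measurable random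
  variables by factoring them through \<open>X\<close>.  The mean of \<open>w\<close> is zero because it is the mean of its
  conditional expectation given \<open>Y\<close>.
\<close>

lemma complete_classD:
  assumes X: "X \<in> M \<rightarrow>\<^sub>M MX" and Y: "Y \<in> M \<rightarrow>\<^sub>M MY"
    and G: "subalgebra (sigma_field_of M MX X) G"
    and compl: "complete_class M MY X Y (M_class M MX X G)"
    and w: "w \<in> borel_measurable G" "square_integrable M w"
    and z: "AE \<omega> in M. real_cond_exp M (sigma_field_of M MY Y) w \<omega> = 0"
  shows "AE \<omega> in M. w \<omega> = 0"
proof -
  let ?FY = "sigma_field_of M MY Y"
  have FY: "subalgebra M ?FY" using Y by (rule subalgebra_sigma_field_of)
  interpret Y: sigma_finite_subalgebra M ?FY using FY by (rule sigma_finite_subalgebraI)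
  have [measurable]: "w \<in> borel_measurable M" using w(2) by (simp add: square_integrable_def)
  obtain g where g[measurable]: "g \<in> borel_measurable MX"
    and gw: "\<And>\<omega>. \<omega> \<in> space M \<Longrightarrow> g (X \<omega>) = w \<omega>"
    using sigma_field_of_factorization[OF X measurable_from_subalg[OF G w(1)]] by blast
  note [measurable] = X
  have ae: "AE \<omega> in M. g (X \<omega>) = w \<omega>" using gw by auto
  have "(\<integral>\<omega>. g (X \<omega>) \<partial>M) = (\<integral>\<omega>. w \<omega> \<partial>M)"
    using gw by (intro Bochner_Integration.integral_cong) auto
  also have "\<dots> = (\<integral>\<omega>. real_cond_exp M ?FY w \<omega> \<partial>M)"
    using Y.real_cond_exp_int(2)[OF square_integrable_imp_integrable'[OF w(2)]] by simp
  also have "\<dots> = (\<integral>\<omega>. 0 \<partial>M)" by (rule integral_cong_AE) (use z in auto)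
  finally have "(\<integral>\<omega>. g (X \<omega>) \<partial>M) = 0" by simp
  then have "g \<in> M_class M MX X G"
    using square_integrable_cong_AE[OF w(2) _ ae] ae w(1)
    by (auto simp: M_class_def L2_centered_distr_iff[OF X])
  moreover have "AE \<omega> in M. real_cond_exp M ?FY (\<lambda>\<omega>. g (X \<omega>)) \<omega> = 0"
    using Y.real_cond_exp_cong[OF ae] z by auto
  ultimately have "AE \<omega> in M. g (X \<omega>) = 0" using compl by (auto simp: complete_class_def)
  then show ?thesis using ae by eventually_elim simp
qed

lemma complete_sufficient_eq_regression_class:
  assumes X: "X \<in> M \<rightarrow>\<^sub>M MX" and Y: "Y \<in> M \<rightarrow>\<^sub>M MY"
    and G: "subalgebra (sigma_field_of M MX X) G"
    and sdr: "is_sdr M MX MY X Y G"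
    and compl: "complete_class M MY X Y (M_class M MX X G)"
  shows "embed_L2 (joint_law M MX MY X Y) fst (M_class M MX X G) = regression_class M MX MY X Y"
proof (intro set_eqI iffI)
  let ?J = "joint_law M MX MY X Y"
  let ?FX = "sigma_field_of M MX X" and ?FY = "sigma_field_of M MY Y"
  have FX: "subalgebra M ?FX" and FY: "subalgebra M ?FY"
    using X Y by (auto intro: subalgebra_sigma_field_of)
  have GM: "subalgebra M G" using FX G by (rule subalgebra_trans)
  interpret Y: sigma_finite_subalgebra M ?FY using FY by (rule sigma_finite_subalgebraI)
  interpret G: sigma_finite_subalgebra M G using GM by (rule sigma_finite_subalgebraI)
  note tower = sufficient_tower[OF FX FY G sdr[unfolded is_sdr_def]]
  {
    fix h assume "h \<in> embed_L2 ?J fst (M_class M MX X G)"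
    then obtain f where h: "h \<in> borel_measurable (MX \<Otimes>\<^sub>M MY)"
      and f: "f \<in> M_class M MX X G" and hf: "AE \<omega> in M. h (X \<omega>, Y \<omega>) = f (X \<omega>)"
      unfolding embed_M_class_iff[OF X Y] by blast
    from f obtain h0 where f': "f \<in> L2_centered (distr M MX X)" and h0: "h0 \<in> borel_measurable G"
      and fh0: "AE \<omega> in M. f (X \<omega>) = h0 \<omega>" by (auto simp: M_class_def)
    have [measurable]: "h0 \<in> borel_measurable M" using GM h0 by (rule measurable_from_subalg)
    have sh0: "square_integrable M h0"
      by (rule square_integrable_cong_AE[of M "\<lambda>\<omega>. f (X \<omega>)"])
        (use f' fh0 in \<open>auto simp: L2_centered_distr_iff[OF X]\<close>)
    have hh0: "AE \<omega> in M. h (X \<omega>, Y \<omega>) = h0 \<omega>" using hf fh0 by eventually_elim simp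
    have "(\<integral>z. h z * k z \<partial>?J) = 0" if k: "k \<in> ominus ?J (L2_X M MX MY X Y) (L2_Y M MX MY X Y)" for k
    proof -
      obtain r where k': "k \<in> borel_measurable (MX \<Otimes>\<^sub>M MY)" and r: "r \<in> L2_centered (distr M MX X)"
        and kr: "AE \<omega> in M. k (X \<omega>, Y \<omega>) = r (X \<omega>)"
        using k unfolding ominus_def L2_X_iff[OF X Y] by blast
      let ?u = "\<lambda>\<omega>. r (X \<omega>)"
      have rm: "r \<in> borel_measurable MX" and u: "square_integrable M ?u"
        using r by (auto simp: L2_centered_distr_iff[OF X])
      have um[measurable]: "?u \<in> borel_measurable M" using X rm by measurable
      have "AE \<omega> in M. real_cond_exp M ?FY ?u \<omega> = 0"
        using X_minus_Y_iff[OF X Y k' r kr] k by simp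
      then have "AE \<omega> in M. real_cond_exp M ?FY (real_cond_exp M G ?u) \<omega> = 0"
        using tower[OF u measurable_sigma_field_of[OF X rm]] by eventually_elim simp
      then have z: "AE \<omega> in M. real_cond_exp M G ?u \<omega> = 0"
        by (rule complete_classD[OF X Y G compl borel_measurable_cond_exp
              square_integrable_cond_exp[OF GM u]])
      have "(\<integral>z. h z * k z \<partial>?J) = (\<integral>\<omega>. h0 \<omega> * ?u \<omega> \<partial>M)"
        by (rule integral_joint_law_mult[OF X Y h k' _ _ hh0 kr]) auto
      also have "\<dots> = (\<integral>\<omega>. h0 \<omega> * real_cond_exp M G ?u \<omega> \<partial>M)"
        using integral_mult_cond_exp[OF GM sh0 h0 u] by simp
      also have "\<dots> = (\<integral>\<omega>. 0 \<partial>M)" by (rule integral_cong_AE) (use z in auto)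
      finally show ?thesis by simp
    qed
    then show "h \<in> regression_class M MX MY X Y"
      using h f' hf by (auto simp: regression_class_def L2_X_iff[OF X Y] ominus_def[of _ _ "ominus _ _ _"])
  next
    fix h assume "h \<in> regression_class M MX MY X Y"
    then have hX: "h \<in> L2_X M MX MY X Y"
      and orth: "\<And>k. k \<in> ominus ?J (L2_X M MX MY X Y) (L2_Y M MX MY X Y) \<Longrightarrow> (\<integral>z. h z * k z \<partial>?J) = 0"
      by (auto simp: regression_class_def ominus_def[of _ _ "ominus _ _ _"])
    obtain f where h: "h \<in> borel_measurable (MX \<Otimes>\<^sub>M MY)" and f: "f \<in> L2_centered (distr M MX X)"
      and hf: "AE \<omega> in M. h (X \<omega>, Y \<omega>) = f (X \<omega>)"
      using hX unfolding L2_X_iff[OF X Y] by blast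
    define u where "u \<omega> = f (X \<omega>)" for \<omega>
    define w where "w = real_cond_exp M G u"
    have fm[measurable]: "f \<in> borel_measurable MX" and u: "square_integrable M u" "(\<integral>\<omega>. u \<omega> \<partial>M) = 0"
      using f by (auto simp: L2_centered_distr_iff[OF X] u_def[abs_def])
    have uX: "u \<in> borel_measurable ?FX"
      unfolding u_def by (rule measurable_sigma_field_of[OF X fm])
    have w: "square_integrable M w" "w \<in> borel_measurable G"
      using square_integrable_cond_exp[OF GM u(1)] by (auto simp: w_def)
    note [measurable] = X Y h u(1)[unfolded square_integrable_def, THEN conjunct1]
      w(1)[unfolded square_integrable_def, THEN conjunct1]
    have iu: "integrable M u" and iw: "integrable M w"
      using u w by (auto intro: square_integrable_imp_integrable')
    have d: "square_integrable M (\<lambda>\<omega>. u \<omega> - w \<omega>)" using u(1) w(1) by (rule square_integrable_diff)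
    have dX: "(\<lambda>\<omega>. u \<omega> - w \<omega>) \<in> borel_measurable ?FX"
      using uX measurable_from_subalg[OF G w(2)] by simp
    \<comment> \<open>\<open>u - w\<close> is a function of \<open>X\<close> in the kernel of \<open>P\<^sub>Y\<close>, hence an admissible test function for \<open>h\<close>\<close>
    obtain r where r[measurable]: "r \<in> borel_measurable MX"
      and rd: "\<And>\<omega>. \<omega> \<in> space M \<Longrightarrow> r (X \<omega>) = u \<omega> - w \<omega>"
      using sigma_field_of_factorization[OF X dX] by blast
    have aer: "AE \<omega> in M. r (X \<omega>) = u \<omega> - w \<omega>" using rd by auto
    have "(\<integral>\<omega>. r (X \<omega>) \<partial>M) = (\<integral>\<omega>. u \<omega> - w \<omega> \<partial>M)"
      using rd by (intro Bochner_Integration.integral_cong) auto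
    also have "\<dots> = 0"
      using iu iw G.real_cond_exp_int(2)[OF iu] by (simp add: w_def)
    finally have rL: "r \<in> L2_centered (distr M MX X)"
      using square_integrable_cong_AE[OF d _ aer] by (simp add: L2_centered_distr_iff[OF X])
    have "AE \<omega> in M. real_cond_exp M ?FY (\<lambda>\<omega>. r (X \<omega>)) \<omega> = real_cond_exp M ?FY (\<lambda>\<omega>. u \<omega> - w \<omega>) \<omega>"
      by (rule Y.real_cond_exp_cong[OF aer]) auto
    then have "AE \<omega> in M. real_cond_exp M ?FY (\<lambda>\<omega>. r (X \<omega>)) \<omega> = 0"
      using Y.real_cond_exp_diff[OF iu iw] tower[OF u(1) uX]
      by eventually_elim (simp add: w_def)
    then have "(\<lambda>z. r (fst z)) \<in> ominus ?J (L2_X M MX MY X Y) (L2_Y M MX MY X Y)"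
      by (subst X_minus_Y_iff[OF X Y _ rL]) auto
    then have "0 = (\<integral>z. h z * r (fst z) \<partial>?J)" using orth by simp
    also have "\<dots> = (\<integral>\<omega>. u \<omega> * (u \<omega> - w \<omega>) \<partial>M)"
      by (rule integral_joint_law_mult[OF X Y h]) (use hf aer in \<open>auto simp: u_def\<close>)
    also have "\<dots> = (\<integral>\<omega>. u \<omega> * u \<omega> \<partial>M) - (\<integral>\<omega>. u \<omega> * w \<omega> \<partial>M)"
      using square_integrable_mult[OF u(1) u(1)] square_integrable_mult[OF u(1) w(1)]
      by (simp add: right_diff_distrib)
    finally have 1: "(\<integral>\<omega>. u \<omega> * u \<omega> \<partial>M) = (\<integral>\<omega>. u \<omega> * w \<omega> \<partial>M)" by simp
    have 2: "(\<integral>\<omega>. w \<omega> * w \<omega> \<partial>M) = (\<integral>\<omega>. u \<omega> * w \<omega> \<partial>M)"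
      using integral_mult_cond_exp[OF GM w u(1)] by (simp add: w_def mult.commute)
    have "AE \<omega> in M. u \<omega> = w \<omega>"
      by (rule AE_eq_if_square_dist_nonpos[OF u(1) w(1)]) (simp add: 1 2)
    then have "f \<in> M_class M MX X G" using f w(2) by (auto simp: M_class_def u_def)
    then show "h \<in> embed_L2 ?J fst (M_class M MX X G)"
      using h hf unfolding embed_M_class_iff[OF X Y] by blast
  }
qed

text \<open>
  The analogue of Bahadur's theorem that a complete sufficient statistic is minimal sufficient.
\<close>

lemma complete_sufficient_is_central:
  assumes X: "X \<in> M \<rightarrow>\<^sub>M MX" and Y: "Y \<in> M \<rightarrow>\<^sub>M MY"
    and G: "subalgebra (sigma_field_of M MX X) G"
    and sdr: "is_sdr M MX MY X Y G"
    and compl: "complete_class M MY X Y (M_class M MX X G)"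
  shows "is_central_sigma_field M MX MY X Y G"
  unfolding is_central_sigma_field_def
proof (intro conjI allI impI G sdr; elim conjE)
  fix H assume H: "subalgebra (sigma_field_of M MX X) H" and sdrH: "is_sdr M MX MY X Y H"
  let ?FX = "sigma_field_of M MX X" and ?FY = "sigma_field_of M MY Y"
  have FX: "subalgebra M ?FX" and FY: "subalgebra M ?FY"
    using X Y by (auto intro: subalgebra_sigma_field_of)
  have GM: "subalgebra M G" and HM: "subalgebra M H"
    using FX G H by (auto intro: subalgebra_trans)
  interpret Y: sigma_finite_subalgebra M ?FY using FY by (rule sigma_finite_subalgebraI)
  show "sets_le_mod_null M G H"
    unfolding sets_le_mod_null_def
  proof
    fix A assume A: "A \<in> sets G"
    then have [measurable]: "A \<in> sets M" using GM by (auto simp: subalgebra_def)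
    define u where "u = (indicator A :: _ \<Rightarrow> real)"
    have uG: "u \<in> borel_measurable G" using A by (simp add: u_def)
    have u: "square_integrable M u"
      by (auto simp: u_def intro: square_integrable_indicator)
    define v where "v = real_cond_exp M H u"
    define w where "w = real_cond_exp M G v"
    have v: "square_integrable M v" "v \<in> borel_measurable H"
      using square_integrable_cond_exp[OF HM u] by (auto simp: v_def)
    have w: "square_integrable M w" "w \<in> borel_measurable G"
      using square_integrable_cond_exp[OF GM v(1)] by (auto simp: w_def)
    have iu: "integrable M u" and iw: "integrable M w"
      using u w by (auto intro: square_integrable_imp_integrable')
    \<comment> \<open>sufficiency of \<open>H\<close> applies to \<open>u\<close>, then that of \<open>G\<close> to the \<open>H\<close>-measurable \<open>v\<close>\<close>
    have "AE x in M. real_cond_exp M ?FY v x = real_cond_exp M ?FY u x"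
      unfolding v_def using sdrH
      by (intro sufficient_tower[OF FX FY H _ u] measurable_from_subalg[OF G uG]) (simp add: is_sdr_def)
    moreover have "AE x in M. real_cond_exp M ?FY w x = real_cond_exp M ?FY v x"
      unfolding w_def using sdr
      by (intro sufficient_tower[OF FX FY G _ v(1)] measurable_from_subalg[OF H v(2)]) (simp add: is_sdr_def)
    ultimately have "AE x in M. real_cond_exp M ?FY (\<lambda>x. w x - u x) x = 0"
      using Y.real_cond_exp_diff[OF iw iu] by eventually_elim simp
    then have "AE x in M. w x - u x = 0"
      by (rule complete_classD[OF X Y G compl borel_measurable_diff[OF w(2) uG]
            square_integrable_diff[OF w(1) u]])
    then have "AE x in M. u x = v x"
      unfolding v_def by (intro fixed_by_two_projections[OF GM HM u]) (simp add: w_def v_def)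
    \<comment> \<open>the set in \<open>H\<close> that replaces \<open>A\<close> is where the conditional probability of \<open>A\<close> given \<open>H\<close> equals 1\<close>
    then have ae: "AE x in M. x \<notin> (A - {x \<in> space H. v x = 1}) \<union> ({x \<in> space H. v x = 1} - A)"
      using AE_space
      by eventually_elim (use HM in \<open>auto simp: u_def subalgebra_def indicator_def split: if_splits\<close>)
    have BH: "{x \<in> space H. v x = 1} \<in> sets H" using v(2) by measurable
    then have "{x \<in> space H. v x = 1} \<in> sets M" using HM by (auto simp: subalgebra_def)
    then have "(A - {x \<in> space H. v x = 1}) \<union> ({x \<in> space H. v x = 1} - A) \<in> null_sets M"
      using ae by (subst AE_iff_null_sets) auto
    then show "\<exists>B\<in>sets H. (A - B) \<union> (B - A) \<in> null_sets M" using BH by blast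
  qed
qed

end

lemma M_class_mono_mod_null:
  assumes "sets_le_mod_null M F G" "subalgebra M F"
  shows "M_class M MX X F \<subseteq> M_class M MX X G"
proof
  fix f assume "f \<in> M_class M MX X F"
  then obtain h where f: "f \<in> L2_centered (distr M MX X)" and h: "h \<in> borel_measurable F"
    "AE \<omega> in M. f (X \<omega>) = h \<omega>" by (auto simp: M_class_def)
  obtain k where k: "k \<in> borel_measurable G" "AE \<omega> in M. k \<omega> = h \<omega>"
    using modification_measurable_mod_null[OF assms h(1)] by blast
  have "AE \<omega> in M. f (X \<omega>) = k \<omega>" using h(2) k(2) by eventually_elim simp
  then show "f \<in> M_class M MX X G" using f k(1) by (auto simp: M_class_def)
qed

text \<open>
  The central \<open>\<sigma>\<close>-field is an arbitrary choice among the minimal ones, and any two of them are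
  contained in each other modulo null sets.
\<close>

lemma central_class_eq:
  assumes X: "X \<in> M \<rightarrow>\<^sub>M MX" and G: "is_central_sigma_field M MX MY X Y G"
  shows "central_class M MX MY X Y = M_class M MX X G"
proof -
  define C where "C = central_sigma_field M MX MY X Y"
  have C: "is_central_sigma_field M MX MY X Y C"
    unfolding C_def central_sigma_field_def using G by (rule someI)
  have "subalgebra M C" "subalgebra M G"
    using C G subalgebra_trans[OF subalgebra_sigma_field_of[OF X]]
    by (auto simp: is_central_sigma_field_def)
  moreover have "sets_le_mod_null M C G" "sets_le_mod_null M G C"
    using C G by (auto simp: is_central_sigma_field_def)
  ultimately show ?thesis
    unfolding central_class_def C_def[symmetric] by (intro antisym M_class_mono_mod_null)
qed

theorem theorem3:
  fixes M :: "'w measure" and MX :: "'x measure" and MY :: "'y measure"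
    and X :: "'w \<Rightarrow> 'x" and Y :: "'w \<Rightarrow> 'y"
    and \<kappa> :: "'y \<Rightarrow> 'x measure" and G :: "'w measure"
  assumes "prob_space M"
    and "X \<in> M \<rightarrow>\<^sub>M MX" and "Y \<in> M \<rightarrow>\<^sub>M MY"
    and "regular_cond_distr M MX MY X Y \<kappa>"
    and "dominated_kernel MX MY \<kappa>"
    and "subalgebra (sigma_field_of M MX X) G"
    and "is_sdr M MX MY X Y G"
    and "complete_class M MY X Y (M_class M MX X G)"
  shows "embed_L2 (joint_law M MX MY X Y) fst (M_class M MX X G) = regression_class M MX MY X Y
    \<and> regression_class M MX MY X Y =
        embed_L2 (joint_law M MX MY X Y) fst (central_class M MX MY X Y)"
proof -
  note hyps = assms(2,3,6,7,8)
  have "central_class M MX MY X Y = M_class M MX X G"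
    using central_class_eq[OF assms(2) prob_space.complete_sufficient_is_central[OF assms(1) hyps]] .
  then show ?thesis
    using prob_space.complete_sufficient_eq_regression_class[OF assms(1) hyps] by simp
qed

end
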